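(* Let $G=(V,E)$ be a finite graph, let $A,B\subseteq E$ be chosen independently and uniformly at random and let $\Delta$ be the event that $A\bigtriangleup B$ is eulerian. Then $$\mathrm{Bias}(|A|+|B|\equiv |E|+1\ (\mathrm{mod}\ 3)\mid\Delta)=\mathrm{Bias}(|A|+|B|\equiv |E|+2\ (\mathrm{mod}\ 3)\mid\Delta)$$ and $$\frac{\mathrm{Bias}(|A|+|B|\equiv |E|\ (\mathrm{mod}\ 3)\mid\Delta)-\mathrm{Bias}(|A|+|B|\equiv |E|+1\ (\mathrm{mod}\ 3)\mid\Delta)}{\mathrm{Bias}(|A|+|B|\equiv |E|\ (\mathrm{mod}\ 3))-\mathrm{Bias}(|A|+|B|\equiv |E|+1\ (\mathrm{mod}\ 3))}=4^{r(G)}(-3)^{n(G)}\,T\!\left(G;-\tfrac{1}{2},-\tfrac{1}{3}\right).$$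
   Context: Graphs are finite; loops and parallel edges are permitted. A subset $A\subseteq E$ is identified with the subgraph $(V,A)$ of $G$; it is called eulerian if all its vertex degrees are even (a loop contributes 2 to the degree). $\bigtriangleup$ is symmetric difference of sets. For $A\subseteq E$, $r(A)=|V|-k(A)$, where $k(A)$ is the number of connected components of $(V,A)$; $r(G)=r(E)$ and $n(G)=|E|-r(G)$. The Tutte polynomial is $T(G;x,y)=\sum_{A\subseteq E}(x-1)^{r(E)-r(A)}(y-1)^{|A|-r(A)}$. For an event $\Sigma$, $\mathrm{Bias}(\Sigma)=\mathbb{P}(\Sigma)-\mathbb{P}(\overline{\Sigma})$ and $\mathrm{Bias}(\Sigma\mid\Delta)=\mathbb{P}(\Sigma\mid\Delta)-\mathbb{P}(\overline{\Sigma}\mid\Delta)$, where $\overline{\Sigma}$ is the complement of $\Sigma$. *)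

theory Defs
  imports "HOL-Probability.Probability" "HOL-Number_Theory.Cong"
begin

(* The ends of an edge form a multiset of size 2, so that loops ({#v, v#}) and
   parallel edges (distinct edges with equal ends) are both available. *)

record ('v, 'e) multigraph =
  verts :: "'v set"
  edges :: "'e set"
  ends :: "'e \<Rightarrow> 'v multiset"

locale finite_multigraph =
  fixes G :: "('v, 'e) multigraph"
  assumes finite_verts: "finite (verts G)"
    and finite_edges: "finite (edges G)"
    and size_ends: "e \<in> edges G \<Longrightarrow> size (ends G e) = 2"
    and ends_in_verts: "e \<in> edges G \<Longrightarrow> set_mset (ends G e) \<subseteq> verts G"

definition vertex_degree :: "('v, 'e) multigraph \<Rightarrow> 'e set \<Rightarrow> 'v \<Rightarrow> nat" where
  "vertex_degree G A v = (\<Sum>e\<in>A. count (ends G e) v)"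

definition eulerian :: "('v, 'e) multigraph \<Rightarrow> 'e set \<Rightarrow> bool" where
  "eulerian G A \<longleftrightarrow> (\<forall>v\<in>verts G. even (vertex_degree G A v))"

definition adjacency :: "('v, 'e) multigraph \<Rightarrow> 'e set \<Rightarrow> 'v rel" where
  "adjacency G A = {(u, v). \<exists>e\<in>A. ends G e = {#u, v#}}"

definition connectivity :: "('v, 'e) multigraph \<Rightarrow> 'e set \<Rightarrow> 'v rel" where
  "connectivity G A = {(u, v). u \<in> verts G \<and> v \<in> verts G \<and> (u, v) \<in> (adjacency G A)\<^sup>*}"

definition num_components :: "('v, 'e) multigraph \<Rightarrow> 'e set \<Rightarrow> nat" where
  "num_components G A = card (verts G // connectivity G A)"

(* The subtractions on nat below never truncate for a finite multigraph and A \<subseteq> edges G: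
   num_components G A \<le> card (verts G), and
   subset_rank G A \<le> card A, subset_rank G A \<le> subset_rank G (edges G). *)

definition subset_rank :: "('v, 'e) multigraph \<Rightarrow> 'e set \<Rightarrow> nat" where
  "subset_rank G A = card (verts G) - num_components G A"

definition graph_rank :: "('v, 'e) multigraph \<Rightarrow> nat" where
  "graph_rank G = subset_rank G (edges G)"

definition graph_nullity :: "('v, 'e) multigraph \<Rightarrow> nat" where
  "graph_nullity G = card (edges G) - graph_rank G"

definition tutte :: "('v, 'e) multigraph \<Rightarrow> 'a::comm_ring_1 \<Rightarrow> 'a \<Rightarrow> 'a" where
  "tutte G x y =
    (\<Sum>A\<in>Pow (edges G).
      (x - 1) ^ (subset_rank G (edges G) - subset_rank G A) * (y - 1) ^ (card A - subset_rank G A))"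

definition bias :: "'a measure \<Rightarrow> ('a \<Rightarrow> bool) \<Rightarrow> real" where
  "bias M P = \<P>(\<omega> in M. P \<omega>) - \<P>(\<omega> in M. \<not> P \<omega>)"

definition cond_bias :: "'a measure \<Rightarrow> ('a \<Rightarrow> bool) \<Rightarrow> ('a \<Rightarrow> bool) \<Rightarrow> real" where
  "cond_bias M P Q = \<P>(\<omega> in M. P \<omega> \<bar> Q \<omega>) - \<P>(\<omega> in M. \<not> P \<omega> \<bar> Q \<omega>)"

definition edge_subset_pair_pmf :: "('v, 'e) multigraph \<Rightarrow> ('e set \<times> 'e set) pmf" where
  "edge_subset_pair_pmf G = pair_pmf (pmf_of_set (Pow (edges G))) (pmf_of_set (Pow (edges G)))"

definition sym_diff_eulerian :: "('v, 'e) multigraph \<Rightarrow> 'e set \<times> 'e set \<Rightarrow> bool" where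
  "sym_diff_eulerian G = (\<lambda>(A, B). eulerian G (sym_diff A B))"

definition sizes_cong :: "('v, 'e) multigraph \<Rightarrow> nat \<Rightarrow> 'e set \<times> 'e set \<Rightarrow> bool" where
  "sizes_cong G i = (\<lambda>(A, B). [card A + card B = card (edges G) + i] (mod 3))"

end

(* Grouping the pairs (A, B) by S = sym_diff A B and weighting them by a cube root of unity to the
   power |A| + |B| - |E|, each edge of S contributes 1 + 1 = 2 and each edge outside S contributes
   w + w^-1 = -1.  Hence the difference of the conditional biases is, up to normalisation, the
   eulerian generating function sum_S 2^|S| (-1)^(|E| - |S|), and the unconditional one is the same
   sum over all S, which is (2 - 1)^|E| = 1.  Writing -1 = 2 - 3 turns the generating function into
   a sum over all edge sets F weighted by the number 2^(|F| - r(F)) of eulerian subsets of F; this is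
   the subset expansion of the Tutte polynomial at (-1/2, -1/3). *)

theory Submission
  imports Defs
begin

section \<open>Signs of edge ends, and sets closed under an equivalence\<close>

lemma prod_power_count_pair:
  assumes "finite X"
  shows "(\<Prod>v\<in>X. (c::'a::comm_semiring_1) ^ count {#u, w#} v) =
    (if u \<in> X then c else 1) * (if w \<in> X then c else 1)"
proof -
  have "(\<Prod>v\<in>X. c ^ count {#u, w#} v) =
      (\<Prod>v\<in>X. (if v = u then c else 1) * (if v = w then c else 1))"
    by (rule prod.cong) auto
  then show ?thesis
    using assms by (simp add: prod.distrib prod.delta)
qed

text \<open>A closed set is the union of the classes it contains, and distinct sets of classes have
  distinct unions because classes are disjoint and nonempty. So a closed set amounts to a free
  choice for each class.\<close>

lemma card_unions_of_classes:
  assumes "equiv V R" "finite V"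
  shows "card {X. X \<subseteq> V \<and> (\<forall>(u, v)\<in>R. u \<in> X \<longrightarrow> v \<in> X)} = 2 ^ card (V // R)"
proof -
  have "bij_betw Union (Pow (V // R)) {X. X \<subseteq> V \<and> (\<forall>(u, v)\<in>R. u \<in> X \<longrightarrow> v \<in> X)}"
  proof (rule bij_betw_byWitness[where f' = "\<lambda>X. {C \<in> V // R. C \<subseteq> X}"])
    show "\<forall>S\<in>Pow (V // R). {C \<in> V // R. C \<subseteq> \<Union>S} = S"
    proof (intro ballI equalityI subsetI)
      fix S C assume S: "S \<in> Pow (V // R)" and C: "C \<in> {C \<in> V // R. C \<subseteq> \<Union>S}"
      then obtain x where "x \<in> C"
        using in_quotient_imp_non_empty[OF assms(1)] by blast
      then obtain D where "D \<in> S" "x \<in> D"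
        using C by blast
      then show "C \<in> S"
        using quotient_disj[OF assms(1), of C D] S C \<open>x \<in> C\<close> by blast
    qed blast
    show "\<forall>X\<in>{X. X \<subseteq> V \<and> (\<forall>(u, v)\<in>R. u \<in> X \<longrightarrow> v \<in> X)}. \<Union>{C \<in> V // R. C \<subseteq> X} = X"
    proof (intro ballI equalityI subsetI)
      fix X x assume X: "X \<in> {X. X \<subseteq> V \<and> (\<forall>(u, v)\<in>R. u \<in> X \<longrightarrow> v \<in> X)}" and x: "x \<in> X"
      then have "x \<in> V"
        by blast
      then have "R `` {x} \<in> V // R" "x \<in> R `` {x}"
        using quotientI equiv_class_self[OF assms(1)] by fast+
      moreover have "R `` {x} \<subseteq> X"
        using X x by blast
      ultimately show "x \<in> \<Union>{C \<in> V // R. C \<subseteq> X}"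
        by blast
    qed blast
    show "Union ` Pow (V // R) \<subseteq> {X. X \<subseteq> V \<and> (\<forall>(u, v)\<in>R. u \<in> X \<longrightarrow> v \<in> X)}"
      using in_quotient_imp_subset[OF assms(1)] in_quotient_imp_closed[OF assms(1)] by fast
    show "(\<lambda>X. {C \<in> V // R. C \<subseteq> X}) ` {X. X \<subseteq> V \<and> (\<forall>(u, v)\<in>R. u \<in> X \<longrightarrow> v \<in> X)} \<subseteq> Pow (V // R)"
      by blast
  qed
  then have "card (Pow (V // R)) = card {X. X \<subseteq> V \<and> (\<forall>(u, v)\<in>R. u \<in> X \<longrightarrow> v \<in> X)}"
    by (rule bij_betw_same_card)
  moreover have "R \<subseteq> V \<times> V"
    using assms(1) by (simp add: equiv_def)
  ultimately show ?thesis
    using finite_quotient[OF assms(2)] by (simp add: card_Pow)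
qed

section \<open>Eulerian subsets, components and rank\<close>

context finite_multigraph
begin

lemma finite_subset_edges: "F \<subseteq> edges G \<Longrightarrow> finite F"
  using finite_edges finite_subset by blast

lemma equiv_connectivity: "equiv (verts G) (connectivity G F)"
proof (rule equivI)
  have "sym (adjacency G F)"
    by (auto simp: sym_def adjacency_def add_mset_commute)
  then have "sym ((adjacency G F)\<^sup>*)"
    by (rule sym_rtrancl)
  then show "sym (connectivity G F)"
    by (auto simp: sym_def connectivity_def)
qed (auto simp: connectivity_def refl_on_def trans_def)

text \<open>Closure under single edges extends along paths by induction, so these \<open>X\<close>
  are the unions of components. The converse uses that edges of \<open>F\<close> have their ends in
  \<open>verts G\<close>, which places \<open>adjacency\<close> inside
  \<open>connectivity\<close>.\<close>

lemma card_uncrossed_vertex_sets: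
  assumes "F \<subseteq> edges G"
  shows "card {X. X \<subseteq> verts G \<and> (\<forall>(u, v)\<in>adjacency G F. u \<in> X \<longrightarrow> v \<in> X)} = 2 ^ num_components G F"
proof -
  have "(\<forall>(u, v)\<in>adjacency G F. u \<in> X \<longrightarrow> v \<in> X) \<longleftrightarrow> (\<forall>(u, v)\<in>connectivity G F. u \<in> X \<longrightarrow> v \<in> X)"
    for X
  proof
    assume adj: "\<forall>(u, v)\<in>adjacency G F. u \<in> X \<longrightarrow> v \<in> X"
    have "v \<in> X" if "(u, v) \<in> (adjacency G F)\<^sup>*" "u \<in> X" for u v
      using that by (induction rule: rtrancl_induct) (use adj in auto)
    then show "\<forall>(u, v)\<in>connectivity G F. u \<in> X \<longrightarrow> v \<in> X"
      by (auto simp: connectivity_def)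
  next
    assume con: "\<forall>(u, v)\<in>connectivity G F. u \<in> X \<longrightarrow> v \<in> X"
    have "adjacency G F \<subseteq> connectivity G F"
      using ends_in_verts assms by (fastforce simp: adjacency_def connectivity_def)
    then show "\<forall>(u, v)\<in>adjacency G F. u \<in> X \<longrightarrow> v \<in> X"
      using con by blast
  qed
  then show ?thesis
    using card_unions_of_classes[OF equiv_connectivity finite_verts] by (simp add: num_components_def)
qed

text \<open>A factor is 2 at a vertex of even degree and 0 at one of odd degree, so a single odd
  vertex kills the product.\<close>

lemma prod_one_plus_sign_degree:
  "(\<Prod>v\<in>verts G. 1 + (-1) ^ vertex_degree G S v) = (if eulerian G S then 2 ^ card (verts G) else (0::int))"
proof (cases "eulerian G S")
  case True
  then have "(\<Prod>v\<in>verts G. 1 + (-1) ^ vertex_degree G S v) = (\<Prod>v\<in>verts G. (2::int))"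
    by (intro prod.cong) (auto simp: eulerian_def)
  then show ?thesis
    using True by simp
next
  case False
  then show ?thesis
    using finite_verts by (force simp: eulerian_def intro!: prod_zero)
qed

text \<open>The inner sign is -1 exactly when one end of \<open>e\<close> lies in \<open>X\<close>
  and the other does not. Such an edge contributes the factor 0, every other edge the factor
  2.\<close>

lemma prod_one_plus_sign_ends:
  assumes "F \<subseteq> edges G" "X \<subseteq> verts G"
  shows "(\<Prod>e\<in>F. 1 + (\<Prod>v\<in>X. (-1) ^ count (ends G e) v)) =
    (if \<forall>(u, v)\<in>adjacency G F. u \<in> X \<longrightarrow> v \<in> X then 2 ^ card F else (0::int))"
proof -
  have fin: "finite X" "finite F"
    using assms finite_verts finite_subset finite_subset_edges by blast+
  have sign: "(\<Prod>v\<in>X. (-1) ^ count (ends G e) v) = (if u \<in> X \<longleftrightarrow> v \<in> X then 1 else (-1::int))"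
    if "ends G e = {#u, v#}" for e u v
    \<comment> \<open>A loop (\<open>u = v\<close>) needs no case of its own: its two equal factors
      multiply to 1.\<close>
    unfolding that by (subst prod_power_count_pair[OF fin(1)]) auto
  show ?thesis
  proof (cases "\<forall>(u, v)\<in>adjacency G F. u \<in> X \<longrightarrow> v \<in> X")
    case True
    have "1 + (\<Prod>v\<in>X. (-1) ^ count (ends G e) v) = (2::int)" if "e \<in> F" for e
    proof -
      have "size (ends G e) = Suc 1"
        using size_ends that assms(1) by auto
      then obtain u N where N: "ends G e = add_mset u N" "size N = 1"
        using size_eq_Suc_imp_eq_union[of "ends G e" 1] by auto
      then obtain v where uv: "ends G e = {#u, v#}"
        using size_1_singleton_mset by metis
      then have "(u, v) \<in> adjacency G F" "(v, u) \<in> adjacency G F"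
        using that by (auto simp: adjacency_def add_mset_commute)
      then have "u \<in> X \<longleftrightarrow> v \<in> X"
        using True by blast
      then show ?thesis
        by (simp add: sign[OF uv])
    qed
    then show ?thesis
      using True by simp
  next
    case False
    then obtain u v e where "e \<in> F" and uv: "ends G e = {#u, v#}" and "u \<in> X" "v \<notin> X"
      by (auto simp: adjacency_def)
    have "1 + (\<Prod>v\<in>X. (-1) ^ count (ends G e) v) = (0::int)"
      using sign[OF uv] \<open>u \<in> X\<close> \<open>v \<notin> X\<close> by simp
    then show ?thesis
      using False fin(2) \<open>e \<in> F\<close> by (auto intro!: prod_zero)
  qed
qed

text \<open>Both sides equal the sum of the signs \<open>(-1) ^ (\<Sum>v\<in>X. deg\<^sub>S v)\<close> over all
  \<open>S \<subseteq> F\<close> and \<open>X \<subseteq> verts G\<close>: summing over \<open>X\<close> first detects eulerian \<open>S\<close>, summing over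
  \<open>S\<close> first detects the \<open>X\<close> that no edge of \<open>F\<close> leaves.\<close>

lemma card_eulerian_subsets_mult:
  assumes F: "F \<subseteq> edges G"
  shows "2 ^ card (verts G) * card {S. S \<subseteq> F \<and> eulerian G S} = 2 ^ card F * 2 ^ num_components G F"
proof -
  have fF: "finite F"
    using F by (rule finite_subset_edges)
  have sgn: "(\<Prod>v\<in>X. (-1) ^ vertex_degree G S v) = (\<Prod>e\<in>S. \<Prod>v\<in>X. (-1::int) ^ count (ends G e) v)"
    for X S
    unfolding vertex_degree_def power_sum by (rule prod.swap)
  have "(\<Sum>S\<in>Pow F. \<Prod>v\<in>verts G. 1 + (-1::int) ^ vertex_degree G S v) =
      (\<Sum>S\<in>Pow F. \<Sum>X\<in>Pow (verts G). \<Prod>v\<in>X. (-1) ^ vertex_degree G S v)"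
    \<comment> \<open>\<open>prod_add\<close> expands over the vertices that take the first summand;
      after the swap these take the sign and the remaining ones contribute 1.\<close>
    using finite_verts by (subst add.commute) (simp add: prod_add)
  also have "\<dots> = (\<Sum>X\<in>Pow (verts G). \<Sum>S\<in>Pow F. \<Prod>v\<in>X. (-1) ^ vertex_degree G S v)"
    by (rule sum.swap)
  also have "\<dots> = (\<Sum>X\<in>Pow (verts G). \<Prod>e\<in>F. 1 + (\<Prod>v\<in>X. (-1) ^ count (ends G e) v))"
    using fF by (subst add.commute) (simp add: prod_add sgn)
  also have "\<dots> = (\<Sum>X\<in>Pow (verts G).
      if \<forall>(u, v)\<in>adjacency G F. u \<in> X \<longrightarrow> v \<in> X then 2 ^ card F else 0)"
    using F by (intro sum.cong) (auto simp: prod_one_plus_sign_ends)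
  also have "\<dots> = 2 ^ card F * int (card {X. X \<subseteq> verts G \<and> (\<forall>(u, v)\<in>adjacency G F. u \<in> X \<longrightarrow> v \<in> X)})"
    using finite_verts by (simp add: sum.If_cases Int_def mult.commute)
  finally have "(\<Sum>S\<in>Pow F. if eulerian G S then 2 ^ card (verts G) else (0::int)) =
      2 ^ card F * 2 ^ num_components G F"
    by (simp add: prod_one_plus_sign_degree card_uncrossed_vertex_sets[OF F])
  then have "int (2 ^ card (verts G) * card {S. S \<subseteq> F \<and> eulerian G S}) = int (2 ^ card F * 2 ^ num_components G F)"
    using fF by (simp add: sum.If_cases Int_def mult.commute)
  then show ?thesis
    by (simp only: of_nat_eq_iff)
qed

lemma num_components_le_card_verts:
  assumes "F \<subseteq> edges G"
  shows "num_components G F \<le> card (verts G)"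
proof -
  have "card {X. X \<subseteq> verts G \<and> (\<forall>(u, v)\<in>adjacency G F. u \<in> X \<longrightarrow> v \<in> X)} \<le> card (Pow (verts G))"
    using finite_verts by (intro card_mono) auto
  then show ?thesis
    using assms finite_verts by (simp add: card_uncrossed_vertex_sets card_Pow)
qed

text \<open>More edges leave fewer uncrossed vertex sets, and their number is a power of 2 with
  exponent \<open>num_components\<close>.\<close>

lemma num_components_antimono:
  assumes "F \<subseteq> F'" "F' \<subseteq> edges G"
  shows "num_components G F' \<le> num_components G F"
proof -
  have "adjacency G F \<subseteq> adjacency G F'"
    using assms by (auto simp: adjacency_def)
  then have "card {X. X \<subseteq> verts G \<and> (\<forall>(u, v)\<in>adjacency G F'. u \<in> X \<longrightarrow> v \<in> X)}
      \<le> card {X. X \<subseteq> verts G \<and> (\<forall>(u, v)\<in>adjacency G F. u \<in> X \<longrightarrow> v \<in> X)}"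
    using finite_verts by (intro card_mono) auto
  then show ?thesis
    using assms card_uncrossed_vertex_sets[of F] card_uncrossed_vertex_sets[of F'] by simp
qed

lemma subset_rank_mono:
  "F \<subseteq> F' \<Longrightarrow> F' \<subseteq> edges G \<Longrightarrow> subset_rank G F \<le> subset_rank G F'"
  using num_components_antimono by (simp add: subset_rank_def diff_le_mono2)

lemma eulerian_empty: "eulerian G {}"
  by (simp add: eulerian_def vertex_degree_def)

text \<open>The empty set is eulerian, so the double count bounds \<open>2 ^ card (verts G)\<close>
  by \<open>2 ^ (card F + num_components G F)\<close>.\<close>

lemma subset_rank_le_card:
  assumes "F \<subseteq> edges G"
  shows "subset_rank G F \<le> card F"
proof -
  have "finite {S. S \<subseteq> F \<and> eulerian G S}"
    using finite_subset_edges[OF assms] by simp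
  then have "card {S. S \<subseteq> F \<and> eulerian G S} \<noteq> 0"
    using eulerian_empty by auto
  then have "2 ^ card (verts G) \<le> 2 ^ card (verts G) * card {S. S \<subseteq> F \<and> eulerian G S}"
    by simp
  also have "\<dots> = 2 ^ (card F + num_components G F)"
    using card_eulerian_subsets_mult[OF assms] by (simp add: power_add)
  finally have "card (verts G) \<le> card F + num_components G F"
    by simp
  then show ?thesis
    by (simp add: subset_rank_def)
qed

text \<open>This is the size of the cycle space of \<open>F\<close> over GF(2), whose dimension is
  the nullity of \<open>F\<close>. It follows by cancelling \<open>2 ^ card (verts G)\<close> in the
  double count.\<close>

lemma card_eulerian_subsets:
  assumes "F \<subseteq> edges G"
  shows "card {S. S \<subseteq> F \<and> eulerian G S} = 2 ^ (card F - subset_rank G F)"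
proof -
  have "card (verts G) + (card F - subset_rank G F) = card F + num_components G F"
    using subset_rank_le_card[OF assms] num_components_le_card_verts[OF assms]
    by (simp add: subset_rank_def)
  then have "2 ^ card (verts G) * card {S. S \<subseteq> F \<and> eulerian G S} =
      2 ^ card (verts G) * 2 ^ (card F - subset_rank G F)"
    using card_eulerian_subsets_mult[OF assms] by (simp flip: power_add)
  then show ?thesis
    by simp
qed

section \<open>From the eulerian generating function to the Tutte polynomial\<close>

lemma eulerian_sum_eq_rank_sum:
  "(\<Sum>S | S \<subseteq> edges G \<and> eulerian G S. 2 ^ card S * (-1) ^ (card (edges G) - card S)) =
    (\<Sum>F\<in>Pow (edges G). 2 ^ card F * (-3) ^ (card (edges G) - card F) *
      (2 ^ (card F - subset_rank G F) :: real))"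
proof -
  let ?E = "edges G"
  define w where "w F = 2 ^ card F * (-3::real) ^ (card ?E - card F)" for F :: "'e set"
  have weight: "2 ^ card S * (-1) ^ (card ?E - card S) = (\<Sum>F | S \<subseteq> F \<and> F \<subseteq> ?E. w F)"
    if S: "S \<subseteq> ?E" for S
  proof -
    have fS: "finite S" "finite (?E - S)"
      using finite_edges finite_subset_edges[OF S] by auto
    \<comment> \<open>Each edge outside \<open>S\<close> picks 2 or -3. With \<open>X\<close> the
      edges that pick 2, the set \<open>F = S \<union> X\<close> runs over all supersets of
      \<open>S\<close>, and the weight depends on \<open>F\<close> alone.\<close>
    have "(-1) ^ card (?E - S) = (\<Prod>e\<in>?E - S. 2 + (-3::real))"
      by simp
    also have "\<dots> = (\<Sum>X\<in>Pow (?E - S). 2 ^ card X * (-3) ^ card (?E - S - X))"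
      unfolding prod_add[OF fS(2)] by simp
    finally have "2 ^ card S * (-1) ^ card (?E - S) =
        (\<Sum>X\<in>Pow (?E - S). 2 ^ card S * (2 ^ card X * (-3::real) ^ card (?E - S - X)))"
      by (simp add: sum_distrib_left)
    also have "\<dots> = (\<Sum>F | S \<subseteq> F \<and> F \<subseteq> ?E. w F)"
    proof (rule sum.reindex_bij_witness[where i = "\<lambda>F. F - S" and j = "\<lambda>X. S \<union> X"])
      fix X assume X: "X \<in> Pow (?E - S)"
      then have "finite X"
        using fS(2) finite_subset by blast
      then have "card (S \<union> X) = card S + card X"
        using X fS by (intro card_Un_disjoint) auto
      moreover have diff: "?E - S - X = ?E - (S \<union> X)"
        by blast
      have "card (?E - S - X) = card ?E - card (S \<union> X)"
        unfolding diff using X S fS \<open>finite X\<close> by (intro card_Diff_subset) auto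
      ultimately show "w (S \<union> X) = 2 ^ card S * (2 ^ card X * (-3) ^ card (?E - S - X))"
        by (simp add: w_def power_add)
    qed (use S in auto)
    finally show ?thesis
      using S fS by (simp add: card_Diff_subset)
  qed
  have "(\<Sum>S | S \<subseteq> ?E \<and> eulerian G S. 2 ^ card S * (-1) ^ (card ?E - card S)) =
      (\<Sum>S | S \<subseteq> ?E \<and> eulerian G S. \<Sum>F | F \<in> Pow ?E \<and> S \<subseteq> F. w F)"
    by (rule sum.cong) (auto simp: weight intro!: arg_cong[of _ _ "sum w"])
  also have "\<dots> = (\<Sum>F\<in>Pow ?E. \<Sum>S | S \<in> {S. S \<subseteq> ?E \<and> eulerian G S} \<and> S \<subseteq> F. w F)"
    using finite_edges by (intro sum.swap_restrict) auto
  also have "\<dots> = (\<Sum>F\<in>Pow ?E. w F * card {S. S \<subseteq> F \<and> eulerian G S})"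
  proof (rule sum.cong)
    fix F assume "F \<in> Pow ?E"
    then have "{S. S \<in> {S. S \<subseteq> ?E \<and> eulerian G S} \<and> S \<subseteq> F} = {S. S \<subseteq> F \<and> eulerian G S}"
      by auto
    then show "(\<Sum>S | S \<in> {S. S \<subseteq> ?E \<and> eulerian G S} \<and> S \<subseteq> F. w F) =
        w F * card {S. S \<subseteq> F \<and> eulerian G S}"
      by (simp add: mult.commute)
  qed simp
  also have "\<dots> = (\<Sum>F\<in>Pow ?E. w F * 2 ^ (card F - subset_rank G F))"
    by (simp add: card_eulerian_subsets)
  finally show ?thesis
    by (simp add: w_def)
qed

text \<open>The identity holds term by term in \<open>F\<close>: here x - 1 = -3/2 and y - 1 = -4/3
  = 4/(-3), and the factor \<open>2 ^ graph_rank G\<close> clears the powers of 2 in the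
  denominators.\<close>

lemma eulerian_sum_eq_tutte:
  "2 ^ graph_rank G * (\<Sum>S | S \<subseteq> edges G \<and> eulerian G S. 2 ^ card S * (-1) ^ (card (edges G) - card S)) =
    4 ^ graph_rank G * (-3) ^ graph_nullity G * (tutte G (-1/2) (-1/3) :: real)"
proof -
  let ?E = "edges G"
  have "2 ^ graph_rank G * (2 ^ card F * (-3) ^ (card ?E - card F) * 2 ^ (card F - subset_rank G F)) =
      4 ^ graph_rank G * (-3) ^ graph_nullity G *
        ((-1/2 - 1) ^ (subset_rank G ?E - subset_rank G F) * ((-1/3 - 1) ^ (card F - subset_rank G F)) :: real)"
    if F: "F \<subseteq> ?E" for F
  proof -
    \<comment> \<open>In terms of rank \<open>s\<close>, corank \<open>k\<close> and nullity
      \<open>m\<close> of \<open>F\<close>, every exponent becomes a sum of free parameters.\<close>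
    define s k m where "s = subset_rank G F" and "k = subset_rank G ?E - s" and "m = card F - s"
    define n where "n = graph_nullity G"
    have r: "graph_rank G = s + k" "card F = s + m" "card ?E = s + k + n"
      using subset_rank_mono[OF F] subset_rank_le_card[OF F] subset_rank_le_card[of ?E]
      by (simp_all add: s_def k_def m_def n_def graph_rank_def graph_nullity_def)
    have "card F \<le> card ?E"
      using F finite_edges by (rule card_mono[rotated])
    \<comment> \<open>Here \<open>k + n - m\<close> is \<open>card ?E - card F\<close>, so the
      natural subtraction in the exponent does not truncate.\<close>
    then have "m \<le> k + n"
      using r by simp
    then have "(-3::real) ^ (k + n - m) * (-3) ^ m = (-3) ^ k * (-3) ^ n"
      by (simp flip: power_add)
    then have split: "(-3::real) ^ (k + n - m) = (-3) ^ k * (-3) ^ n / (-3) ^ m"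
      by (simp add: field_simps)
    have quot: "(-1/2 - 1 :: real) ^ k = (-3) ^ k / 2 ^ k" "(-1/3 - 1 :: real) ^ m = 4 ^ m / (-3) ^ m"
      by (simp_all flip: power_divide)
    have four: "(4::real) ^ j = 2 ^ j * 2 ^ j" for j
      by (simp flip: power_mult_distrib)
    have "2 ^ (s + k) * (2 ^ (s + m) * (-3) ^ (k + n - m) * 2 ^ m) =
        4 ^ (s + k) * (-3) ^ n * ((-1/2 - 1) ^ k * ((-1/3 - 1) ^ m) :: real)"
      unfolding split quot four power_add by simp
    then show ?thesis
      unfolding n_def[symmetric] s_def[symmetric] k_def[symmetric] m_def[symmetric] r by simp
  qed
  then show ?thesis
    unfolding eulerian_sum_eq_rank_sum tutte_def sum_distrib_left by (intro sum.cong) auto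
qed

end

section \<open>Character sums modulo 3 over pairs of edge sets\<close>

text \<open>This is \<open>2 * cos (2 * pi * k / 3)\<close>, the sum of the nontrivial characters modulo 3.\<close>

definition two_cos3 :: "int \<Rightarrow> int" where
  "two_cos3 k = (if 3 dvd k then 2 else -1)"

text \<open>On three consecutive integers the values are 2, -1, -1 in some order, with sum 0. This
  is the source of the factor -1 for an edge outside \<open>S\<close>.\<close>

lemma two_cos3_add: "two_cos3 (k + 1) + two_cos3 (k - 1) = - two_cos3 k"
  unfolding two_cos3_def by presburger

lemma sum_Pow_insert:
  assumes "finite E" "e \<notin> E"
  shows "(\<Sum>A\<in>Pow (insert e E). f A) = (\<Sum>A\<in>Pow E. f A + f (insert e A))"
proof -
  have "inj_on (insert e) (Pow E)"
    using assms(2) by (intro inj_onI) (metis Pow_iff insert_ident subsetD)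
  moreover have "Pow E \<inter> insert e ` Pow E = {}"
    using assms(2) by blast
  ultimately show ?thesis
    using assms(1) by (simp add: Pow_insert sum.union_disjoint sum.reindex sum.distrib)
qed

text \<open>Induction on \<open>E\<close>. An edge of \<open>S\<close> lies in exactly one of
  \<open>A\<close> and \<open>sym_diff A S\<close>, which cancels its share of
  \<open>card E\<close>: both choices agree and give a factor 2. An edge outside \<open>S\<close>
  lies in both or in neither and shifts the argument by 1 or -1, so \<open>k\<close> must be
  arbitrary. Writing \<open>S \<inter> E\<close> lets \<open>S\<close> stay fixed while
  \<open>E\<close> grows.\<close>

lemma sum_two_cos3:
  assumes "finite E"
  shows "(\<Sum>A\<in>Pow E. two_cos3 (k + int (card A) + int (card (sym_diff A (S \<inter> E))) - int (card E))) =
    2 ^ card (S \<inter> E) * (-1) ^ card (E - S) * two_cos3 k"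
  using assms
proof (induction E arbitrary: k rule: finite_induct)
  case (insert e E)
  define h where "h k A = two_cos3 (k + int (card A) + int (card (sym_diff A (S \<inter> E))) - int (card E))" for k A
  have IH: "(\<Sum>A\<in>Pow E. h k A) = 2 ^ card (S \<inter> E) * (-1) ^ card (E - S) * two_cos3 k" for k
    using insert.IH by (simp add: h_def)
  have new: "A \<subseteq> E \<Longrightarrow> finite A \<and> e \<notin> A \<and> finite (sym_diff A (S \<inter> E)) \<and> e \<notin> sym_diff A (S \<inter> E)" for A
    using insert.hyps finite_subset by auto
  show ?case
  proof (cases "e \<in> S")
    case True
    have "sym_diff A (S \<inter> insert e E) = insert e (sym_diff A (S \<inter> E))"
      "sym_diff (insert e A) (S \<inter> insert e E) = sym_diff A (S \<inter> E)" if "A \<subseteq> E" for A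
      using that True insert.hyps by auto
    then have "(\<Sum>A\<in>Pow (insert e E). two_cos3 (k + int (card A) +
        int (card (sym_diff A (S \<inter> insert e E))) - int (card (insert e E)))) =
        (\<Sum>A\<in>Pow E. h k A + h k A)"
      unfolding sum_Pow_insert[OF insert.hyps]
      by (intro sum.cong) (use new insert.hyps in \<open>auto simp: h_def algebra_simps\<close>)
    also have "\<dots> = 2 * 2 ^ card (S \<inter> E) * (-1) ^ card (E - S) * two_cos3 k"
      unfolding sum.distrib IH by simp
    finally show ?thesis
      using True insert.hyps by (simp add: insert_Diff_if)
  next
    case False
    have "sym_diff A (S \<inter> insert e E) = sym_diff A (S \<inter> E)"
      "sym_diff (insert e A) (S \<inter> insert e E) = insert e (sym_diff A (S \<inter> E))" if "A \<subseteq> E" for A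
      using that False insert.hyps by auto
    then have "(\<Sum>A\<in>Pow (insert e E). two_cos3 (k + int (card A) +
        int (card (sym_diff A (S \<inter> insert e E))) - int (card (insert e E)))) =
        (\<Sum>A\<in>Pow E. h (k - 1) A + h (k + 1) A)"
      unfolding sum_Pow_insert[OF insert.hyps]
      by (intro sum.cong) (use new insert.hyps in \<open>auto simp: h_def algebra_simps\<close>)
    also have "\<dots> = 2 ^ card (S \<inter> E) * (-1) ^ card (E - S) * (two_cos3 (k + 1) + two_cos3 (k - 1))"
      by (simp add: sum.distrib IH algebra_simps)
    finally show ?thesis
      using False insert.hyps by (simp add: two_cos3_add insert_Diff_if)
  qed
qed simp

text \<open>For fixed \<open>A\<close>, symmetric difference with \<open>A\<close> is an involution,
  so a pair \<open>(A, B)\<close> is encoded by \<open>A\<close> and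
  \<open>S = sym_diff A B\<close>.\<close>

lemma sum_sym_diff_pairs:
  fixes f :: "'a set \<Rightarrow> 'a set \<Rightarrow> 'b::comm_monoid_add"
  assumes "finite E"
  shows "(\<Sum>(A, B) | A \<subseteq> E \<and> B \<subseteq> E \<and> R (sym_diff A B). f A B) =
    (\<Sum>S | S \<subseteq> E \<and> R S. \<Sum>A\<in>Pow E. f A (sym_diff A S))"
proof -
  have inv: "sym_diff A (sym_diff A B) = B" for A B :: "'a set"
    by blast
  have "(\<Sum>(A, B) | A \<subseteq> E \<and> B \<subseteq> E \<and> R (sym_diff A B). f A B) =
      (\<Sum>(S, A)\<in>{S. S \<subseteq> E \<and> R S} \<times> Pow E. f A (sym_diff A S))"
    by (rule sum.reindex_bij_witness[where i = "\<lambda>(S, A). (A, sym_diff A S)"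
          and j = "\<lambda>(A, B). (sym_diff A B, A)"]) (auto simp: inv)
  then show ?thesis
    by (simp add: sum.cartesian_product)
qed

section \<open>Biases under uniform distributions as counts\<close>

lemma cond_bias_pmf_of_set:
  assumes "finite U" "{x \<in> U. Q x} \<noteq> {}"
  shows "cond_bias (measure_pmf (pmf_of_set U)) P Q = 2 * card {x \<in> U. P x \<and> Q x} / card {x \<in> U. Q x} - 1"
proof -
  have U: "U \<noteq> {}"
    using assms(2) by blast
  have pr: "measure (measure_pmf (pmf_of_set U)) {x. R x} = card {x \<in> U. R x} / card U" for R
    by (simp add: measure_pmf_of_set[OF U assms(1)] Int_def)
  \<comment> \<open>The final -1 is minus a quotient of equal counts, which needs a nonzero
    denominator since division by 0 yields 0.\<close>
  have Q: "card {x \<in> U. Q x} \<noteq> 0"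
    using assms by simp
  have "card {x \<in> U. Q x} = card ({x \<in> U. P x \<and> Q x} \<union> {x \<in> U. \<not> P x \<and> Q x})"
    by (rule arg_cong[of _ _ card]) blast
  also have "\<dots> = card {x \<in> U. P x \<and> Q x} + card {x \<in> U. \<not> P x \<and> Q x}"
    using assms(1) by (intro card_Un_disjoint) auto
  finally have "real (card {x \<in> U. \<not> P x \<and> Q x}) =
      real (card {x \<in> U. Q x}) - real (card {x \<in> U. P x \<and> Q x})"
    by simp
  moreover have "cond_bias (measure_pmf (pmf_of_set U)) P Q =
      card {x \<in> U. P x \<and> Q x} / card {x \<in> U. Q x} - card {x \<in> U. \<not> P x \<and> Q x} / card {x \<in> U. Q x}"
    using U assms(1) by (simp add: cond_bias_def cond_prob_def pr)
  ultimately show ?thesis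
    using Q by (simp add: diff_divide_distrib)
qed

lemma bias_eq_cond_bias: "bias (measure_pmf p) P = cond_bias (measure_pmf p) P (\<lambda>_. True)"
  by (simp add: bias_def cond_bias_def cond_prob_def)

lemma edge_subset_pair_pmf_eq:
  assumes "finite (edges G)"
  shows "edge_subset_pair_pmf G = pmf_of_set (Pow (edges G) \<times> Pow (edges G))"
proof (rule pmf_eqI)
  have Pow: "Pow (edges G) \<noteq> {}" "finite (Pow (edges G))"
    using assms by auto
  moreover from this have "Pow (edges G) \<times> Pow (edges G) \<noteq> {}" "finite (Pow (edges G) \<times> Pow (edges G))"
    by auto
  ultimately show "pmf (edge_subset_pair_pmf G) p = pmf (pmf_of_set (Pow (edges G) \<times> Pow (edges G))) p" for p
    by (cases p) (simp add: edge_subset_pair_pmf_def pmf_pair card_cartesian_product indicator_times del: Pow_iff)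
qed

section \<open>Counting pairs by residue modulo 3\<close>

lemma sizes_cong_iff:
  "sizes_cong G i (A, B) \<longleftrightarrow> 3 dvd (int (card A) + int (card B) - int (card (edges G)) - int i)"
proof -
  \<comment> \<open>Over the integers the difference of the two sides may be negative without
    truncating.\<close>
  have "sizes_cong G i (A, B) \<longleftrightarrow> [int (card A + card B) = int (card (edges G) + i)] (mod 3)"
    using cong_int_iff[of "card A + card B" "card (edges G) + i" 3] by (simp add: sizes_cong_def)
  then show ?thesis
    by (simp add: cong_iff_dvd_diff algebra_simps)
qed

lemma two_cos3_eq:
  "two_cos3 (int (card A) + int (card B) - int (card (edges G))) =
    2 * of_bool (sizes_cong G 0 (A, B)) - of_bool (sizes_cong G 1 (A, B)) - of_bool (sizes_cong G 2 (A, B))"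
  unfolding two_cos3_def sizes_cong_iff of_bool_def by presburger

text \<open>Complementing both sets fixes \<open>sym_diff A B\<close> and negates \<open>card A + card B - card (edges G)\<close>.\<close>

lemma card_sizes_cong_1_eq_2:
  assumes "finite (edges G)"
  shows "card {(A, B). A \<subseteq> edges G \<and> B \<subseteq> edges G \<and> R (sym_diff A B) \<and> sizes_cong G 1 (A, B)} =
    card {(A, B). A \<subseteq> edges G \<and> B \<subseteq> edges G \<and> R (sym_diff A B) \<and> sizes_cong G 2 (A, B)}"
proof -
  let ?E = "edges G"
  let ?c = "\<lambda>(A, B). (?E - A, ?E - B)"
  have sd: "sym_diff (?E - A) (?E - B) = sym_diff A B" if "A \<subseteq> ?E" "B \<subseteq> ?E" for A B
    using that by blast
  have card: "int (card (?E - A)) = int (card ?E) - int (card A)" if "A \<subseteq> ?E" for A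
    using that assms by (simp add: card_Diff_subset card_mono finite_subset of_nat_diff)
  have "sizes_cong G 2 (?E - A, ?E - B) \<longleftrightarrow> sizes_cong G 1 (A, B)"
    "sizes_cong G 1 (?E - A, ?E - B) \<longleftrightarrow> sizes_cong G 2 (A, B)" if "A \<subseteq> ?E" "B \<subseteq> ?E" for A B
    unfolding sizes_cong_iff card[OF that(1)] card[OF that(2)] by presburger+
  then have "bij_betw ?c
      {(A, B). A \<subseteq> ?E \<and> B \<subseteq> ?E \<and> R (sym_diff A B) \<and> sizes_cong G 1 (A, B)}
      {(A, B). A \<subseteq> ?E \<and> B \<subseteq> ?E \<and> R (sym_diff A B) \<and> sizes_cong G 2 (A, B)}"
    by (intro bij_betw_byWitness[where f' = ?c]) (auto simp: sd)
  then show ?thesis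
    by (rule bij_betw_same_card)
qed

text \<open>Writing N0, N1, N2 for the numbers of pairs in the three residue classes, summing
  \<open>two_cos3\<close> over the pairs gives 2 N0 - N1 - N2, which is 2 (N0 - N1) by the
  complement symmetry. Grouping the same sum by symmetric difference evaluates it.\<close>

lemma card_sizes_cong_diff:
  assumes "finite (edges G)"
  shows "int (card {(A, B). A \<subseteq> edges G \<and> B \<subseteq> edges G \<and> R (sym_diff A B) \<and> sizes_cong G 0 (A, B)}) -
      int (card {(A, B). A \<subseteq> edges G \<and> B \<subseteq> edges G \<and> R (sym_diff A B) \<and> sizes_cong G 1 (A, B)}) =
    (\<Sum>S | S \<subseteq> edges G \<and> R S. 2 ^ card S * (-1) ^ (card (edges G) - card S))"
proof -
  let ?E = "edges G"
  let ?D = "{(A, B). A \<subseteq> ?E \<and> B \<subseteq> ?E \<and> R (sym_diff A B)}"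
  let ?N = "\<lambda>i. card {(A, B). A \<subseteq> ?E \<and> B \<subseteq> ?E \<and> R (sym_diff A B) \<and> sizes_cong G i (A, B)}"
  have "finite ?D"
    by (rule finite_subset[of _ "Pow ?E \<times> Pow ?E"]) (use assms in auto)
  then have N: "(\<Sum>p\<in>?D. of_bool (sizes_cong G i p)) = int (?N i)" for i
    by (simp add: Int_def) (auto intro!: arg_cong[of _ _ card])
  have "(\<Sum>(A, B)\<in>?D. two_cos3 (int (card A) + int (card B) - int (card ?E))) =
      (\<Sum>p\<in>?D. 2 * of_bool (sizes_cong G 0 p) - of_bool (sizes_cong G 1 p) - of_bool (sizes_cong G 2 p))"
    by (rule sum.cong) (auto simp: two_cos3_eq)
  also have "\<dots> = 2 * int (?N 0) - int (?N 1) - int (?N 2)"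
    by (simp only: sum_subtractf sum_distrib_left[symmetric] N)
  finally have "2 * (int (?N 0) - int (?N 1)) =
      (\<Sum>(A, B)\<in>?D. two_cos3 (int (card A) + int (card B) - int (card ?E)))"
    using card_sizes_cong_1_eq_2[OF assms, of R] by simp
  also have "\<dots> = (\<Sum>S | S \<subseteq> ?E \<and> R S. \<Sum>A\<in>Pow ?E.
      two_cos3 (int (card A) + int (card (sym_diff A S)) - int (card ?E)))"
    by (rule sum_sym_diff_pairs[OF assms])
  also have "\<dots> = (\<Sum>S | S \<subseteq> ?E \<and> R S. 2 * (2 ^ card S * (-1) ^ (card ?E - card S)))"
  proof (rule sum.cong)
    fix S assume "S \<in> {S. S \<subseteq> ?E \<and> R S}"
    then have "S \<inter> ?E = S" "card (?E - S) = card ?E - card S"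
      using assms by (auto simp: card_Diff_subset finite_subset)
    then show "(\<Sum>A\<in>Pow ?E. two_cos3 (int (card A) + int (card (sym_diff A S)) - int (card ?E))) =
        2 * (2 ^ card S * (-1) ^ (card ?E - card S))"
      using sum_two_cos3[OF assms, of 0 S] by (simp add: two_cos3_def)
  qed simp
  finally show ?thesis
    by (simp flip: sum_distrib_left)
qed

text \<open>The predicate \<open>R\<close> on the symmetric difference is kept general so that the
  eulerian event and the sure event are both instances. The set \<open>S0\<close> guarantees that
  the conditioning event has positive probability.\<close>

lemma cond_bias_sizes_cong:
  assumes fin: "finite (edges G)" and R: "S0 \<subseteq> edges G" "R S0"
    and Q: "\<And>A B. Q (A, B) \<longleftrightarrow> R (sym_diff A B)"
  defines "M \<equiv> measure_pmf (edge_subset_pair_pmf G)"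
  shows "cond_bias M (sizes_cong G 1) Q = cond_bias M (sizes_cong G 2) Q"
    and "cond_bias M (sizes_cong G 0) Q - cond_bias M (sizes_cong G 1) Q =
      2 * (\<Sum>S | S \<subseteq> edges G \<and> R S. 2 ^ card S * (-1) ^ (card (edges G) - card S)) /
        (2 ^ card (edges G) * card {S. S \<subseteq> edges G \<and> R S})"
proof -
  let ?E = "edges G"
  let ?U = "Pow ?E \<times> Pow ?E"
  let ?N = "\<lambda>i. card {(A, B). A \<subseteq> ?E \<and> B \<subseteq> ?E \<and> R (sym_diff A B) \<and> sizes_cong G i (A, B)}"
  have "({}, S0) \<in> {p \<in> ?U. Q p}"
    using R by (simp add: Q)
  then have ne: "{p \<in> ?U. Q p} \<noteq> {}"
    by blast
  \<comment> \<open>Every admissible \<open>S\<close> is the symmetric difference of exactly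
    \<open>2 ^ card ?E\<close> pairs, one for each \<open>A\<close>.\<close>
  have "int (card {p \<in> ?U. Q p}) = (\<Sum>(A, B) | A \<subseteq> ?E \<and> B \<subseteq> ?E \<and> R (sym_diff A B). 1)"
    by (simp add: case_prod_unfold) (auto intro!: arg_cong[of _ _ card] simp: Q)
  also have "\<dots> = (\<Sum>S | S \<subseteq> ?E \<and> R S. \<Sum>A\<in>Pow ?E. 1)"
    by (rule sum_sym_diff_pairs[OF fin])
  also have "\<dots> = int (2 ^ card ?E * card {S. S \<subseteq> ?E \<and> R S})"
    using fin by (simp add: card_Pow)
  finally have cQ: "card {p \<in> ?U. Q p} = 2 ^ card ?E * card {S. S \<subseteq> ?E \<and> R S}"
    by (simp only: of_nat_eq_iff)
  have "{p \<in> ?U. sizes_cong G i p \<and> Q p} =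
      {(A, B). A \<subseteq> ?E \<and> B \<subseteq> ?E \<and> R (sym_diff A B) \<and> sizes_cong G i (A, B)}" for i
    by (auto simp: Q)
  then have cb: "cond_bias M (sizes_cong G i) Q =
      2 * real (?N i) / (2 ^ card ?E * card {S. S \<subseteq> ?E \<and> R S}) - 1" for i
    using cond_bias_pmf_of_set[OF _ ne, of "sizes_cong G i"] fin
    by (simp add: M_def edge_subset_pair_pmf_eq cQ)
  show "cond_bias M (sizes_cong G 1) Q = cond_bias M (sizes_cong G 2) Q"
    unfolding cb card_sizes_cong_1_eq_2[OF fin] ..
  have "cond_bias M (sizes_cong G 0) Q - cond_bias M (sizes_cong G 1) Q =
      2 * real_of_int (int (?N 0) - int (?N 1)) / (2 ^ card ?E * card {S. S \<subseteq> ?E \<and> R S})"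
    unfolding cb by (simp add: diff_divide_distrib right_diff_distrib)
  then show "cond_bias M (sizes_cong G 0) Q - cond_bias M (sizes_cong G 1) Q =
      2 * (\<Sum>S | S \<subseteq> ?E \<and> R S. 2 ^ card S * (-1) ^ (card ?E - card S)) /
        (2 ^ card ?E * card {S. S \<subseteq> ?E \<and> R S})"
    unfolding card_sizes_cong_diff[OF fin] by simp
qed

theorem theorem2p15:
  fixes G :: "('v, 'e) multigraph"
  assumes "finite_multigraph G"
  defines "M \<equiv> measure_pmf (edge_subset_pair_pmf G)"
  shows "cond_bias M (sizes_cong G 1) (sym_diff_eulerian G) =
           cond_bias M (sizes_cong G 2) (sym_diff_eulerian G) \<and>
         (cond_bias M (sizes_cong G 0) (sym_diff_eulerian G) -
            cond_bias M (sizes_cong G 1) (sym_diff_eulerian G)) /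
         (bias M (sizes_cong G 0) - bias M (sizes_cong G 1)) =
           4 ^ graph_rank G * (- 3) ^ graph_nullity G * tutte G (- 1 / 2) (- 1 / 3)"
proof -
  interpret finite_multigraph G
    by fact
  let ?E = "edges G"
  let ?W = "\<Sum>S | S \<subseteq> ?E \<and> eulerian G S. 2 ^ card S * (-1::real) ^ (card ?E - card S)"
  have euler: "sym_diff_eulerian G (A, B) \<longleftrightarrow> eulerian G (sym_diff A B)" for A B
    by (simp add: sym_diff_eulerian_def)
  note cond = cond_bias_sizes_cong[OF finite_edges empty_subsetI eulerian_empty euler, folded M_def]
  have "1 = (\<Prod>e\<in>?E. 2 + (-1::real))"
    by simp
  also have "\<dots> = (\<Sum>S\<in>Pow ?E. 2 ^ card S * (-1) ^ card (?E - S))"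
    unfolding prod_add[OF finite_edges] by simp
  \<comment> \<open>The conjunct \<open>True\<close> matches the instance of
    \<open>cond_bias_sizes_cong\<close> for the sure event.\<close>
  also have "\<dots> = (\<Sum>S | S \<subseteq> ?E \<and> True. 2 ^ card S * (-1) ^ (card ?E - card S))"
    by (intro sum.cong) (auto simp: card_Diff_subset finite_subset_edges)
  finally have one: "(\<Sum>S | S \<subseteq> ?E \<and> True. 2 ^ card S * (-1) ^ (card ?E - card S)) = (1::real)" ..
  have "card {S. S \<subseteq> ?E \<and> True} = 2 ^ card ?E"
    using card_Pow[OF finite_edges] by (simp add: Pow_def)
  then have bias: "bias M (sizes_cong G 0) - bias M (sizes_cong G 1) = 2 / (2 ^ card ?E * 2 ^ card ?E)"
    using cond_bias_sizes_cong(2)[OF finite_edges empty_subsetI, of "\<lambda>_. True" "\<lambda>_. True"] one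
    by (simp add: M_def bias_eq_cond_bias)
  \<comment> \<open>There are \<open>2 ^ graph_nullity G\<close> eulerian sets in all, so the
    quotient of the two differences leaves \<open>2 ^ card ?E / 2 ^ graph_nullity G\<close>, which
    this equation turns into \<open>2 ^ graph_rank G\<close>.\<close>
  have "card ?E = graph_rank G + graph_nullity G"
    using subset_rank_le_card[of ?E] by (simp add: graph_rank_def graph_nullity_def)
  then have cond_diff: "cond_bias M (sizes_cong G 0) (sym_diff_eulerian G) - cond_bias M (sizes_cong G 1) (sym_diff_eulerian G) =
      2 * ?W / (2 ^ card ?E * 2 ^ graph_nullity G)"
    unfolding cond(2) card_eulerian_subsets[OF subset_refl] by (simp add: graph_rank_def graph_nullity_def)
  have "(cond_bias M (sizes_cong G 0) (sym_diff_eulerian G) -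
            cond_bias M (sizes_cong G 1) (sym_diff_eulerian G)) /
         (bias M (sizes_cong G 0) - bias M (sizes_cong G 1)) = ?W * 2 ^ card ?E / 2 ^ graph_nullity G"
    unfolding cond_diff bias by simp
  also have "\<dots> = 2 ^ graph_rank G * ?W"
    unfolding \<open>card ?E = _\<close> power_add by simp
  finally show ?thesis
    using cond(1) eulerian_sum_eq_tutte by simp
qed

end
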